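(* For $\sigma\in\{132,213\}$, $$A^\sigma(x,q)=1+\frac{1}{1-x}I^\sigma(x,q),\qquad I^\sigma(x)=(1-x)\left(\frac{1-\sqrt{1-4x}}{2x}-1\right),$$ $I^\sigma_1=1$, and for $n\ge2$, $I^\sigma_n=C_n-C_{n-1}$, where $C_n=\frac1{n+1}\binom{2n}n$ is the $n$-th Catalan number.
   Context: For a permutation $\pi=\pi_1\cdots\pi_n$ of $[n]$, let $i_\pi$ be the smallest index $i$ with $\{\pi_1,\dots,\pi_i\}=\{1,\dots,i\}$; $\pi$ is indecomposable if $i_\pi=n$ (the empty permutation is not indecomposable). A permutation $\pi$ avoids a pattern $\tau\in\mathfrak S_k$ if no subsequence $\pi_{j_1}\cdots\pi_{j_k}$ ($j_1<\cdots<j_k$) is order-isomorphic to $\tau$. A descent of $\pi$ is an index $i$ with $\pi_i>\pi_{i+1}$. For a pattern $\sigma$, $A^\sigma_{n,i}$ (resp. $I^\sigma_{n,i}$) is the number of $\sigma$-avoiding permutations (resp. $\sigma$-avoiding indecomposable permutations) of $[n]$ with $i$ descents; $A^\sigma(x,q)=1+\sum_{n\ge1}\sum_iA^\sigma_{n,i}x^nq^i$, $I^\sigma(x,q)=\sum_{n\ge1}\sum_iI^\sigma_{n,i}x^nq^i$, $I^\sigma(x)=I^\sigma(x,1)=\sum_{n\ge1}I^\sigma_nx^n$. *)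

theory Defs
  imports
    Complex_Main
    "HOL-Computational_Algebra.Computational_Algebra"
    "HOL-Combinatorics.Combinatorics"
    "HOL-Library.Sublist"
begin

(* A permutation of [n] is its one-line notation: an element of permutations_of_set {1..n}.
   Lists are indexed from 0, so the entry pi_i is \<pi> ! (i - 1). *)

definition order_isomorphic :: "nat list \<Rightarrow> nat list \<Rightarrow> bool" where
  "order_isomorphic xs ys \<longleftrightarrow> length xs = length ys \<and>
     (\<forall>a < length xs. \<forall>b < length xs. xs ! a < xs ! b \<longleftrightarrow> ys ! a < ys ! b)"

definition avoids :: "nat list \<Rightarrow> nat list \<Rightarrow> bool" where
  "avoids \<pi> \<tau> \<longleftrightarrow> \<not> (\<exists>\<rho>. subseq \<rho> \<pi> \<and> order_isomorphic \<rho> \<tau>)"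

definition first_block :: "nat list \<Rightarrow> nat" where
  "first_block \<pi> = (LEAST i. i \<in> {1..length \<pi>} \<and> set (take i \<pi>) = {1..i})"

(* first_block [] is unspecified, so the empty permutation is excluded explicitly. *)
definition indecomposable :: "nat list \<Rightarrow> bool" where
  "indecomposable \<pi> \<longleftrightarrow> \<pi> \<noteq> [] \<and> first_block \<pi> = length \<pi>"

definition descents :: "nat list \<Rightarrow> nat" where
  "descents \<pi> = card {i. Suc i < length \<pi> \<and> \<pi> ! i > \<pi> ! Suc i}"

definition A_num :: "nat list \<Rightarrow> nat \<Rightarrow> nat \<Rightarrow> nat" where
  "A_num \<sigma> n i =
     card {\<pi> \<in> permutations_of_set {1..n}. avoids \<pi> \<sigma> \<and> descents \<pi> = i}"

definition I_num :: "nat list \<Rightarrow> nat \<Rightarrow> nat \<Rightarrow> nat" where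
  "I_num \<sigma> n i =
     card {\<pi> \<in> permutations_of_set {1..n}. avoids \<pi> \<sigma> \<and> indecomposable \<pi> \<and> descents \<pi> = i}"

(* Series in x and q are elements of R[[q]][[x]]: the outer variable is x, the inner one is q,
   and the coefficient of x^n q^i in F is fps_nth (fps_nth F n) i. *)

definition A_gf :: "nat list \<Rightarrow> real fps fps" where
  "A_gf \<sigma> = 1 + Abs_fps (\<lambda>n. if n \<ge> 1 then Abs_fps (\<lambda>i. real (A_num \<sigma> n i)) else 0)"

definition I_gf :: "nat list \<Rightarrow> real fps fps" where
  "I_gf \<sigma> = Abs_fps (\<lambda>n. if n \<ge> 1 then Abs_fps (\<lambda>i. real (I_num \<sigma> n i)) else 0)"

(* The substitution q = c. It is only meaningful when every coefficient of x^n is a polynomial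
   in q; finite_descent_support below shows that this holds for I_gf. *)
definition specialize_q :: "real \<Rightarrow> real fps fps \<Rightarrow> real fps" where
  "specialize_q c F =
     Abs_fps (\<lambda>n. \<Sum>i | fps_nth (fps_nth F n) i \<noteq> 0. fps_nth (fps_nth F n) i * c ^ i)"

definition I_gf1 :: "nat list \<Rightarrow> real fps" where
  "I_gf1 \<sigma> = specialize_q 1 (I_gf \<sigma>)"

definition catalan :: "nat \<Rightarrow> real" where
  "catalan n = 1 / (real n + 1) * real ((2 * n) choose n)"

(* The formal square root with constant term sqrt (f_0); for f_0 = 1 it is the usual branch. *)
abbreviation fps_sqrt :: "real fps \<Rightarrow> real fps" where
  "fps_sqrt f \<equiv> fps_radical root 2 f"

lemma descents_le: "descents \<pi> \<le> length \<pi>"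
proof -
  have "descents \<pi> \<le> card {..<length \<pi>}"
    unfolding descents_def by (rule card_mono) auto
  then show ?thesis by simp
qed

lemma finite_descent_support: "{i. fps_nth (fps_nth (I_gf \<sigma>) n) i \<noteq> 0} \<subseteq> {..n}"
proof
  fix i assume "i \<in> {i. fps_nth (fps_nth (I_gf \<sigma>) n) i \<noteq> 0}"
  then have "I_num \<sigma> n i \<noteq> 0" by (auto simp: I_gf_def split: if_splits)
  then have "{\<pi> \<in> permutations_of_set {1..n}.
      avoids \<pi> \<sigma> \<and> indecomposable \<pi> \<and> descents \<pi> = i} \<noteq> {}"
    unfolding I_num_def by (metis card.empty)
  then obtain \<pi> where "\<pi> \<in> permutations_of_set {1..n}" "descents \<pi> = i" by blast
  then show "i \<in> {..n}"
    using descents_le[of \<pi>] length_finite_permutations_of_set[of \<pi> "{1..n}"] by simp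
qed

lemma I_gf1_nth:
  assumes "n \<ge> 1"
  shows "fps_nth (I_gf1 \<sigma>) n =
    real (card {\<pi> \<in> permutations_of_set {1..n}. avoids \<pi> \<sigma> \<and> indecomposable \<pi>})"
proof -
  let ?S = "\<lambda>i. {\<pi> \<in> permutations_of_set {1..n}.
    avoids \<pi> \<sigma> \<and> indecomposable \<pi> \<and> descents \<pi> = i}"
  have "fps_nth (I_gf1 \<sigma>) n = (\<Sum>i\<le>n. fps_nth (fps_nth (I_gf \<sigma>) n) i)"
    unfolding I_gf1_def specialize_q_def using finite_descent_support[of \<sigma> n]
    by (simp, intro sum.mono_neutral_left) auto
  also have "\<dots> = real (\<Sum>i\<le>n. card (?S i))"
    using assms by (simp add: I_gf_def I_num_def)
  also have "(\<Sum>i\<le>n. card (?S i)) = card (\<Union>i\<le>n. ?S i)"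
    by (subst card_UN_disjoint) auto
  also have "(\<Union>i\<le>n. ?S i) = {\<pi> \<in> permutations_of_set {1..n}. avoids \<pi> \<sigma> \<and> indecomposable \<pi>}"
  proof -
    have "descents \<pi> \<le> n" if "\<pi> \<in> permutations_of_set {1..n}" for \<pi>
      using descents_le[of \<pi>] length_finite_permutations_of_set[OF that] by simp
    then show ?thesis by auto
  qed
  finally show ?thesis .
qed

(* Division over the coefficient ring R[[q]] (not a field) still inverts 1 - x. *)
lemma one_minus_X_inverse: "1 / (1 - fps_X) * (1 - fps_X) = (1 :: real fps fps)"
proof -
  have sd: "subdegree (1 - fps_X :: real fps fps) = 0" by (intro subdegreeI) auto
  have "1 / (1 - fps_X) = inverse (1 - fps_X :: real fps fps)"
    by (simp add: fps_divide_def sd)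
  also have "\<dots> * (1 - fps_X) = 1"
    using fps_left_inverse'[of 1 "1 - fps_X :: real fps fps" 1]
    by (simp add: fps_inverse_def fps_lr_inverse_one_one)
  finally show ?thesis .
qed

end

theory Submission
  imports Defs
begin

text \<open>
  In a decomposable 132-avoider every nonempty lower block forces the upper block to increase,
  so the decomposable 132-avoiders of $[n+1]$ are exactly the words $\pi\,(n+1)$ with $\pi$ a
  132-avoider of $[n]$, $n \ge 1$. Appending the maximum creates no descent, hence
  $(1-x)(A-1) = I$. Splitting a 132-avoider at its maximum gives $G = 1 + xG^2$ for the counting
  series, that is $(1-2xG)^2 = 1-4x$. The Catalan series $C$ has the same square
  $(1-2xC)^2 = 1-4x$, because the recurrence for $C_n$ turns into a linear differential equation
  that determines this square; so no convolution identity for $C_n$ is needed. Reverse-complement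
  carries 132 to 213 and preserves descents and indecomposability.
\<close>

section \<open>Avoidance of 132 and 213 through subsequences of length three\<close>

lemma order_isomorphic_132:
  "order_isomorphic \<rho> [1, 3, 2] \<longleftrightarrow> (\<exists>a b c. \<rho> = [a, b, c] \<and> a < c \<and> c < b)"
  by (auto simp: order_isomorphic_def length_Suc_conv eval_nat_numeral All_less_Suc less_Suc_eq)

lemma order_isomorphic_213:
  "order_isomorphic \<rho> [2, 1, 3] \<longleftrightarrow> (\<exists>a b c. \<rho> = [a, b, c] \<and> b < a \<and> a < c)"
  by (auto simp: order_isomorphic_def length_Suc_conv eval_nat_numeral All_less_Suc less_Suc_eq)

text \<open>Occurrences of 132 are sorted by the letter that plays 1. The weak order of
  \<open>sorted\<close> is the right one, since two equal letters cannot play 3 and 2.\<close>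

primrec av132 :: "nat list \<Rightarrow> bool" where
  "av132 [] \<longleftrightarrow> True"
| "av132 (x # xs) \<longleftrightarrow> av132 xs \<and> sorted (filter (\<lambda>y. x < y) xs)"

lemma subseq_Cons_Cons_iff:
  "subseq (a # as) (x # xs) \<longleftrightarrow> a = x \<and> subseq as xs \<or> subseq (a # as) xs"
  by (metis subseq_Cons' subseq_Cons2_iff subseq_Cons2_neq list_emb_Cons)

lemma sorted_filter_greater_iff:
  "sorted (filter (\<lambda>y. x < y) xs) \<longleftrightarrow> (\<forall>b c. subseq [b, c] xs \<longrightarrow> \<not> (x < c \<and> c < b))"
  for x :: nat
proof (induction xs)
  case (Cons a xs)
  have "(\<forall>b c. subseq [b, c] (a # xs) \<longrightarrow> \<not> (x < c \<and> c < b)) \<longleftrightarrow>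
      (\<forall>c\<in>set xs. \<not> (x < c \<and> c < a)) \<and> (\<forall>b c. subseq [b, c] xs \<longrightarrow> \<not> (x < c \<and> c < b))"
    unfolding subseq_Cons_Cons_iff subseq_singleton_left by blast
  then show ?case unfolding Cons.IH[symmetric] by (auto simp: not_less)
qed simp

lemma avoids_132_iff_subseq:
  "avoids \<pi> [1, 3, 2] \<longleftrightarrow> (\<forall>a b c. subseq [a, b, c] \<pi> \<longrightarrow> \<not> (a < c \<and> c < b))"
  unfolding avoids_def order_isomorphic_132 by blast

lemma avoids_213_iff_subseq:
  "avoids \<pi> [2, 1, 3] \<longleftrightarrow> (\<forall>a b c. subseq [a, b, c] \<pi> \<longrightarrow> \<not> (b < a \<and> a < c))"
  unfolding avoids_def order_isomorphic_213 by blast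

lemma avoids_132_iff: "avoids \<pi> [1, 3, 2] \<longleftrightarrow> av132 \<pi>"
  unfolding avoids_132_iff_subseq
proof (induction \<pi>)
  case (Cons x \<pi>)
  have "(\<forall>a b c. subseq [a, b, c] (x # \<pi>) \<longrightarrow> \<not> (a < c \<and> c < b)) \<longleftrightarrow>
      (\<forall>a b c. subseq [a, b, c] \<pi> \<longrightarrow> \<not> (a < c \<and> c < b)) \<and>
      (\<forall>b c. subseq [b, c] \<pi> \<longrightarrow> \<not> (x < c \<and> c < b))"
    unfolding subseq_Cons_Cons_iff[of _ "[_, _]"] by blast
  then show ?case by (simp only: Cons.IH av132.simps sorted_filter_greater_iff)
qed simp

text \<open>As the strict maximum, m can only play 3. Hence an occurrence of 132 that lies neither
  in L nor in R takes its 1 from L and its 2 from R; conversely x in L and y in R with x < y give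
  the occurrence x m y.\<close>

lemma av132_append_Cons:
  assumes "\<forall>x\<in>set L. x < m" "\<forall>x\<in>set R. x < m"
  shows "av132 (L @ m # R) \<longleftrightarrow> av132 L \<and> av132 R \<and> (\<forall>x\<in>set L. \<forall>y\<in>set R. y \<le> x)"
  using assms
proof (induction L)
  case Nil
  then have "filter (\<lambda>y. m < y) R = []" by (auto simp: filter_empty_conv)
  then show ?case by simp
next
  case (Cons x L)
  have "sorted (filter (\<lambda>y. x < y) (L @ m # R)) \<longleftrightarrow>
      sorted (filter (\<lambda>y. x < y) L) \<and> (\<forall>y\<in>set R. y \<le> x)"
    using Cons.prems by (fastforce simp: sorted_append filter_empty_conv not_less)
  then show ?case using Cons by auto
qed

lemma av132_map_add: "av132 (map (\<lambda>x. x + m) xs) \<longleftrightarrow> av132 xs"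
  by (induction xs) (auto simp: filter_map o_def sorted_map)

section \<open>Splitting 132-avoiders at their maximum\<close>

definition av132_perms :: "nat set \<Rightarrow> nat list set" where
  "av132_perms S = {\<pi> \<in> permutations_of_set S. av132 \<pi>}"

lemma av132_perms_iff: "\<pi> \<in> av132_perms S \<longleftrightarrow> set \<pi> = S \<and> distinct \<pi> \<and> av132 \<pi>"
  by (auto simp: av132_perms_def permutations_of_set_def)

lemma finite_av132_perms [simp]: "finite (av132_perms S)"
  by (simp add: av132_perms_def)

lemma card_av132_perms_shift: "card (av132_perms {k+1..k+n}) = card (av132_perms {1..n})"
proof -
  have "bij_betw (map (\<lambda>x. x + k)) (av132_perms {1..n}) (av132_perms {k+1..k+n})"
  proof (rule bij_betw_byWitness[where f' = "map (\<lambda>x. x - k)"])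
    show "map (\<lambda>x. x + k) ` av132_perms {1..n} \<subseteq> av132_perms {k+1..k+n}"
      by (auto simp: av132_perms_iff av132_map_add distinct_map add.commute)
    \<comment> \<open>Truncated subtraction undoes the shift because every letter exceeds k. The
      same identity carries \<open>av132\<close> down, through \<open>av132_map_add\<close>.\<close>
    have inv: "map (\<lambda>x. x + k) (map (\<lambda>x. x - k) \<pi>) = \<pi>"
      if "\<pi> \<in> av132_perms {k+1..k+n}" for \<pi>
      using that by (auto simp: av132_perms_iff o_def intro!: map_idI)
    then show "\<forall>\<pi>\<in>av132_perms {k+1..k+n}. map (\<lambda>x. x + k) (map (\<lambda>x. x - k) \<pi>) = \<pi>"
      by blast
    show "map (\<lambda>x. x - k) ` av132_perms {k+1..k+n} \<subseteq> av132_perms {1..n}"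
    proof (rule image_subsetI)
      fix \<pi> assume \<pi>: "\<pi> \<in> av132_perms {k+1..k+n}"
      have "(\<lambda>x. x - k) ` {k+1..k+n} = {1..n}"
      proof (intro equalityI subsetI)
        fix y assume "y \<in> {1..n}"
        then have "y = (y + k) - k" "y + k \<in> {k+1..k+n}" by auto
        then show "y \<in> (\<lambda>x. x - k) ` {k+1..k+n}" by (rule image_eqI)
      qed auto
      moreover have "inj_on (\<lambda>x. x - k) {k+1..k+n}" by (auto simp: inj_on_def)
      moreover have "av132 (map (\<lambda>x. x - k) \<pi>)"
        using \<pi> inv[OF \<pi>] av132_map_add[of k "map (\<lambda>x. x - k) \<pi>"] by (simp only: av132_perms_iff)
      ultimately show "map (\<lambda>x. x - k) \<pi> \<in> av132_perms {1..n}"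
        using \<pi> by (simp add: av132_perms_iff distinct_map)
    qed
  qed (auto simp: o_def)
  then show ?thesis by (simp add: bij_betw_same_card)
qed

text \<open>The cut k is the largest element of A, or 0 if A is empty. It will turn the letters to
  the right and left of the maximum into two intervals.\<close>

lemma initial_segment_split:
  fixes A B :: "nat set"
  assumes un: "A \<union> B = {1..n}" and less: "\<forall>x\<in>A. \<forall>y\<in>B. x < y"
  obtains k where "k \<le> n" "A = {1..k}" "B = {k+1..n}"
proof (cases "A = {}")
  case True
  then show ?thesis using un by (intro that[of 0]) auto
next
  case False
  have fin: "finite A" using un by (metis finite_Un finite_atLeastAtMost)
  have M: "Max A \<in> A" "\<forall>x\<in>A. x \<le> Max A" using fin False by auto
  have "\<forall>y\<in>B. Max A < y" using M less by blast
  then have "x \<in> A \<longleftrightarrow> 1 \<le> x \<and> x \<le> Max A" "x \<in> B \<longleftrightarrow> Max A < x \<and> x \<le> n" for x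
    using un M by (metis Un_iff atLeastAtMost_iff le_trans less_imp_le not_le)+
  then have "A = {1..Max A}" "B = {Max A + 1..n}" by auto
  moreover have "Max A \<le> n" using un M(1) by auto
  ultimately show ?thesis by (rule that[rotated 1])
qed

text \<open>By \<open>av132_append_Cons\<close> and distinctness, all letters left of the maximum
  exceed all letters right of it, so the number k of letters on the right fixes both letter
  sets.\<close>

lemma av132_perms_Suc:
  "av132_perms {1..Suc n} =
     (\<Union>k\<le>n. (\<lambda>(R, L). L @ Suc n # R) ` (av132_perms {1..k} \<times> av132_perms {k+1..n}))"
proof (intro equalityI subsetI)
  fix \<pi> assume "\<pi> \<in> av132_perms {1..Suc n}"
  then have \<pi>: "set \<pi> = {1..Suc n}" "distinct \<pi>" "av132 \<pi>" by (auto simp: av132_perms_iff)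
  then have "Suc n \<in> set \<pi>" by simp
  then obtain L R where eq: "\<pi> = L @ Suc n # R" by (meson split_list)
  have "Suc n \<notin> set L \<union> set R" "insert (Suc n) (set L \<union> set R) = {1..Suc n}"
    using \<pi>(1,2) unfolding eq by simp_all
  then have "set R \<union> set L = {1..Suc n} - {Suc n}" by blast
  also have "\<dots> = {1..n}" by auto
  finally have un: "set R \<union> set L = {1..n}" .
  have lt: "\<forall>x\<in>set L. x < Suc n" "\<forall>x\<in>set R. x < Suc n"
    using un by (metis UnCI atLeastAtMost_iff le_imp_less_Suc)+
  have av: "av132 L" "av132 R" "\<forall>x\<in>set L. \<forall>y\<in>set R. y \<le> x"
    using \<pi>(3) av132_append_Cons[OF lt] unfolding eq by auto
  have "\<forall>y\<in>set R. \<forall>x\<in>set L. y < x"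
    using av(3) \<pi>(2) unfolding eq by (auto simp: le_less)
  with un obtain k where k: "k \<le> n" "set R = {1..k}" "set L = {k+1..n}"
    by (rule initial_segment_split)
  have "distinct L" "distinct R" using \<pi>(2) unfolding eq by simp_all
  then have "(R, L) \<in> av132_perms {1..k} \<times> av132_perms {k+1..n}"
    using k av(1,2) by (simp add: av132_perms_iff)
  then show "\<pi> \<in> (\<Union>k\<le>n. (\<lambda>(R, L). L @ Suc n # R) ` (av132_perms {1..k} \<times> av132_perms {k+1..n}))"
    using k(1) unfolding eq by (intro UN_I[of k] image_eqI[of _ _ "(R, L)"]) simp_all
next
  fix \<pi> assume "\<pi> \<in> (\<Union>k\<le>n. (\<lambda>(R, L). L @ Suc n # R) ` (av132_perms {1..k} \<times> av132_perms {k+1..n}))"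
  then obtain k R L where *: "k \<le> n" "\<pi> = L @ Suc n # R"
    "R \<in> av132_perms {1..k}" "L \<in> av132_perms {k+1..n}" by auto
  have "av132 (L @ Suc n # R)"
    using * by (subst av132_append_Cons) (auto simp: av132_perms_iff)
  then show "\<pi> \<in> av132_perms {1..Suc n}"
    using * by (auto simp: av132_perms_iff)
qed

text \<open>Segner's recurrence: the union over k is disjoint, and the left factor is shifted down
  from {k+1..n} to {1..n-k}.\<close>

lemma card_av132_perms_Suc:
  "card (av132_perms {1..Suc n}) =
     (\<Sum>k\<le>n. card (av132_perms {1..k}) * card (av132_perms {1..n-k}))"
proof -
  let ?f = "\<lambda>(R, L). L @ Suc n # R"
  let ?P = "\<lambda>k. av132_perms {1..k} \<times> av132_perms {k+1..n}"
  \<comment> \<open>\<open>Suc n\<close> lies in none of the four words, so its place in the whole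
    word determines the split. Letting k and k' differ makes this serve both injectivity for one k
    and disjointness, where k is recovered as the number of letters of R.\<close>
  have inj: "(R, L) = (R', L')"
    if "(R, L) \<in> ?P k" "(R', L') \<in> ?P k'" "L @ Suc n # R = L' @ Suc n # R'" "k \<le> n" "k' \<le> n" for k k' R L R' L'
  proof -
    have "Suc n \<notin> set L" "Suc n \<notin> set R" "Suc n \<notin> set L'" "Suc n \<notin> set R'"
      using that by (auto simp: av132_perms_iff)
    then show ?thesis using that(3) by (simp add: append_Cons_eq_iff)
  qed
  have "card (av132_perms {1..Suc n}) = (\<Sum>k\<le>n. card (?f ` ?P k))"
    unfolding av132_perms_Suc
  proof (rule card_UN_disjoint)
    show "\<forall>k\<in>{..n}. \<forall>k'\<in>{..n}. k \<noteq> k' \<longrightarrow> ?f ` ?P k \<inter> ?f ` ?P k' = {}"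
    proof (intro ballI impI)
      fix k k' assume k: "k \<in> {..n}" "k' \<in> {..n}" "k \<noteq> k'"
      have False if \<pi>: "\<pi> \<in> ?f ` ?P k" "\<pi> \<in> ?f ` ?P k'" for \<pi>
      proof -
        obtain R L R' L' where RL: "(R, L) \<in> ?P k" "(R', L') \<in> ?P k'"
          "\<pi> = L @ Suc n # R" "\<pi> = L' @ Suc n # R'"
          using \<pi> by auto
        then have "R = R'" using inj[OF RL(1,2)] k by auto
        moreover have "card (set R) = k" "card (set R') = k'"
          using RL(1,2) by (simp_all add: av132_perms_iff)
        ultimately show False using k by simp
      qed
      then show "?f ` ?P k \<inter> ?f ` ?P k' = {}" by blast
    qed
  qed auto
  also have "\<dots> = (\<Sum>k\<le>n. card (?P k))"
  proof (rule sum.cong[OF refl])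
    fix k assume "k \<in> {..n}"
    then have "inj_on ?f (?P k)"
      by (intro inj_onI) (use inj[of _ _ k _ _ k] in \<open>simp only: split_paired_all prod.case atMost_iff\<close>)
    then show "card (?f ` ?P k) = card (?P k)" by (rule card_image)
  qed
  also have "\<dots> = (\<Sum>k\<le>n. card (av132_perms {1..k}) * card (av132_perms {1..n-k}))"
  proof (rule sum.cong[OF refl])
    fix k assume "k \<in> {..n}"
    then show "card (?P k) = card (av132_perms {1..k}) * card (av132_perms {1..n-k})"
      using card_av132_perms_shift[of k "n - k"] by (simp add: card_cartesian_product)
  qed
  finally show ?thesis .
qed

section \<open>Decomposable 132-avoiders and descents\<close>

lemma first_block_eq_length_iff:
  assumes "\<pi> \<in> permutations_of_set {1..n}" "n \<ge> 1"
  shows "first_block \<pi> = length \<pi> \<longleftrightarrow> (\<forall>i\<in>{1..<n}. set (take i \<pi>) \<noteq> {1..i})"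
proof -
  have len: "length \<pi> = n" and set: "set \<pi> = {1..n}"
    using assms length_finite_permutations_of_set[of \<pi> "{1..n}"]
    by (auto simp: permutations_of_set_def)
  let ?Q = "\<lambda>i. i \<in> {1..length \<pi>} \<and> set (take i \<pi>) = {1..i}"
  \<comment> \<open>The full length always qualifies when n \<ge> 1, so the \<open>LEAST\<close> in
    \<open>first_block\<close> is attained.\<close>
  have Qn: "?Q n" using len set assms by auto
  show ?thesis
  proof
    assume "first_block \<pi> = length \<pi>"
    then show "\<forall>i\<in>{1..<n}. set (take i \<pi>) \<noteq> {1..i}"
      unfolding first_block_def using not_less_Least[of _ ?Q] len by force
  next
    assume *: "\<forall>i\<in>{1..<n}. set (take i \<pi>) \<noteq> {1..i}"
    show "first_block \<pi> = length \<pi>"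
      unfolding first_block_def len
    proof (rule Least_equality)
      show "n \<le> y" if "y \<in> {1..n} \<and> set (take y \<pi>) = {1..y}" for y
        using * that by (meson atLeastAtMost_iff atLeastLessThan_iff not_less)
    qed (use Qn len in auto)
  qed
qed

lemma indecomposable_iff:
  assumes "\<pi> \<in> permutations_of_set {1..n}" "n \<ge> 1"
  shows "indecomposable \<pi> \<longleftrightarrow> (\<forall>i\<in>{1..<n}. set (take i \<pi>) \<noteq> {1..i})"
  using first_block_eq_length_iff[OF assms] assms
  by (auto simp: indecomposable_def permutations_of_set_def)

text \<open>A prefix with letter set {1..i}, i \<le> n, ends before the maximum, so 1 lies to the
  left of it. The split at the maximum puts 1 on the right unless k = 0, that is, unless the maximum
  comes last. Conversely, the word before a final maximum is a proper block, nonempty since n \<ge>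
  1.\<close>

lemma decomposable_av132_perms:
  assumes "n \<ge> 1"
  shows "{\<pi> \<in> av132_perms {1..Suc n}. \<not> indecomposable \<pi>} = (\<lambda>\<pi>. \<pi> @ [Suc n]) ` av132_perms {1..n}"
proof (intro equalityI subsetI)
  fix \<pi> assume *: "\<pi> \<in> {\<pi> \<in> av132_perms {1..Suc n}. \<not> indecomposable \<pi>}"
  then have "\<pi> \<in> permutations_of_set {1..Suc n}" by (auto simp: av132_perms_def)
  with * obtain i where i: "1 \<le> i" "i \<le> n" "set (take i \<pi>) = {1..i}"
    using indecomposable_iff[of \<pi> "Suc n"] by (auto simp: less_Suc_eq_le)
  from * obtain k R L where k: "k \<le> n" "\<pi> = L @ Suc n # R"
    "R \<in> av132_perms {1..k}" "L \<in> av132_perms {k+1..n}"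
    unfolding av132_perms_Suc by auto
  have "i \<le> length L"
  proof (rule ccontr)
    assume "\<not> i \<le> length L"
    then have "Suc n \<in> set (take i \<pi>)" using k(2) by (simp add: take_Cons')
    then show False using i by auto
  qed
  then have "set (take i \<pi>) \<subseteq> set L" using k(2) by (auto dest: in_set_takeD)
  then have "1 \<in> set L" using i by auto
  then have "k = 0" using k by (auto simp: av132_perms_iff)
  then show "\<pi> \<in> (\<lambda>\<pi>. \<pi> @ [Suc n]) ` av132_perms {1..n}"
    using k by (auto simp: av132_perms_iff)
next
  fix \<rho> assume "\<rho> \<in> (\<lambda>\<pi>. \<pi> @ [Suc n]) ` av132_perms {1..n}"
  then obtain \<pi> where \<pi>: "\<rho> = \<pi> @ [Suc n]" "\<pi> \<in> av132_perms {1..n}" by auto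
  have "length \<pi> = n"
    using \<pi>(2) length_finite_permutations_of_set[of \<pi> "{1..n}"] by (simp add: av132_perms_def)
  then have "set (take n \<rho>) = {1..n}" using \<pi> by (simp add: av132_perms_iff)
  moreover have mem: "\<rho> \<in> av132_perms {1..Suc n}"
    using \<pi> av132_append_Cons[of \<pi> "Suc n" "[]"] by (auto simp: av132_perms_iff)
  ultimately show "\<rho> \<in> {\<pi> \<in> av132_perms {1..Suc n}. \<not> indecomposable \<pi>}"
    using indecomposable_iff[of \<rho> "Suc n"] assms by (auto simp: av132_perms_def)
qed

lemma descents_snoc_greater:
  assumes "\<forall>x\<in>set \<pi>. x \<le> m"
  shows "descents (\<pi> @ [m]) = descents \<pi>"
proof -
  have "{i. Suc i < length (\<pi> @ [m]) \<and> (\<pi> @ [m]) ! i > (\<pi> @ [m]) ! Suc i} =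
      {i. Suc i < length \<pi> \<and> \<pi> ! i > \<pi> ! Suc i}"
  proof (rule Collect_cong)
    fix i
    \<comment> \<open>The one new adjacent pair consists of the last letter of \<pi> and m.\<close>
    have "\<pi> ! i \<le> m" if "Suc i = length \<pi>"
      using that assms by (metis lessI nth_mem)
    then show "Suc i < length (\<pi> @ [m]) \<and> (\<pi> @ [m]) ! i > (\<pi> @ [m]) ! Suc i \<longleftrightarrow>
        Suc i < length \<pi> \<and> \<pi> ! i > \<pi> ! Suc i"
      by (cases "Suc i = length \<pi>") (auto simp: nth_append)
  qed
  then show ?thesis by (simp add: descents_def)
qed

text \<open>This is (1-x)(A-1) = I at x^(n+1) q^i: stripping the final maximum of a decomposable
  avoider leaves an arbitrary avoider of [n] with the same descents.\<close>

lemma A_num_132_Suc: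
  assumes "n \<ge> 1"
  shows "A_num [1, 3, 2] (Suc n) i = I_num [1, 3, 2] (Suc n) i + A_num [1, 3, 2] n i"
proof -
  let ?A = "{\<pi> \<in> av132_perms {1..Suc n}. descents \<pi> = i}"
  have "card ?A = card {\<pi> \<in> ?A. indecomposable \<pi>} + card {\<pi> \<in> ?A. \<not> indecomposable \<pi>}"
    by (subst card_Un_disjoint[symmetric]) (auto intro!: arg_cong[where f = card])
  also have "{\<pi> \<in> ?A. \<not> indecomposable \<pi>} =
      {\<pi> \<in> (\<lambda>\<pi>. \<pi> @ [Suc n]) ` av132_perms {1..n}. descents \<pi> = i}"
    unfolding decomposable_av132_perms[OF assms, symmetric] by auto
  also have "\<dots> = (\<lambda>\<pi>. \<pi> @ [Suc n]) ` {\<pi> \<in> av132_perms {1..n}. descents \<pi> = i}"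
    by (auto simp: av132_perms_iff descents_snoc_greater)
  also have "card \<dots> = card {\<pi> \<in> av132_perms {1..n}. descents \<pi> = i}"
    by (rule card_image) (auto simp: inj_on_def)
  finally show ?thesis
    unfolding A_num_def I_num_def avoids_132_iff av132_perms_def by (simp add: conj_ac)
qed

lemma card_indecomposable_132_Suc:
  assumes "n \<ge> 1"
  shows "card {\<pi> \<in> av132_perms {1..Suc n}. indecomposable \<pi>} + card (av132_perms {1..n}) =
    card (av132_perms {1..Suc n})"
proof -
  have "card (av132_perms {1..Suc n}) = card {\<pi> \<in> av132_perms {1..Suc n}. indecomposable \<pi>} +
      card {\<pi> \<in> av132_perms {1..Suc n}. \<not> indecomposable \<pi>}"
    by (subst card_Un_disjoint[symmetric]) (auto intro!: arg_cong[where f = card])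
  also have "card {\<pi> \<in> av132_perms {1..Suc n}. \<not> indecomposable \<pi>} = card (av132_perms {1..n})"
    unfolding decomposable_av132_perms[OF assms] by (rule card_image) (auto simp: inj_on_def)
  finally show ?thesis by simp
qed

lemma indecomposable_singleton: "indecomposable [Suc 0]"
  using indecomposable_iff[of "[Suc 0]" 1] by (simp add: permutations_of_set_def)

section \<open>Reverse-complement and the passage from 132 to 213\<close>

text \<open>The size n is a parameter because subsequences of a permutation of [n] are complemented
  in [n] too, whatever their length.\<close>

definition rev_comp :: "nat \<Rightarrow> nat list \<Rightarrow> nat list" where
  "rev_comp n \<pi> = rev (map (\<lambda>x. n + 1 - x) \<pi>)"

lemma image_reflect: "(\<lambda>x. n + 1 - x) ` {i + 1..n} = {1..n - i}" for n i :: nat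
proof (intro equalityI subsetI)
  fix y assume "y \<in> {1..n - i}"
  then have "y = n + 1 - (n + 1 - y)" "n + 1 - y \<in> {i + 1..n}" by auto
  then show "y \<in> (\<lambda>x. n + 1 - x) ` {i + 1..n}" by (rule image_eqI)
qed auto

lemma rev_comp_in_perms:
  assumes "\<pi> \<in> permutations_of_set {1..n}"
  shows "rev_comp n \<pi> \<in> permutations_of_set {1..n}"
proof -
  have "inj_on (\<lambda>x. n + 1 - x) {1..n}" by (auto simp: inj_on_def)
  then show ?thesis
    using assms image_reflect[of n 0] by (auto simp: permutations_of_set_def rev_comp_def distinct_map)
qed

lemma rev_comp_rev_comp:
  assumes "\<pi> \<in> permutations_of_set {1..n}"
  shows "rev_comp n (rev_comp n \<pi>) = \<pi>"
proof -
  have "set \<pi> = {1..n}" using assms by (simp add: permutations_of_set_def)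
  then show ?thesis by (auto simp: rev_comp_def rev_map o_def intro!: map_idI)
qed

lemma subseq_rev: "subseq xs ys \<Longrightarrow> subseq (rev xs) (rev ys)"
  by (induction rule: list_emb.induct) (auto simp: subseq_rev_drop_many intro!: list_emb_append_mono)

lemma set_subseq: "subseq xs ys \<Longrightarrow> set xs \<subseteq> set ys"
  by (induction rule: list_emb.induct) auto

lemma subseq_rev_comp:
  assumes "subseq \<rho> \<pi>" shows "subseq (rev_comp n \<rho>) (rev_comp n \<pi>)"
  using assms by (simp add: rev_comp_def subseq_map subseq_rev)

text \<open>Reversal turns 213 into 312, and complementation turns 312 into 132.\<close>

lemma avoids_rev_comp:
  assumes "\<pi> \<in> permutations_of_set {1..n}"
  shows "avoids (rev_comp n \<pi>) [1, 3, 2] \<longleftrightarrow> avoids \<pi> [2, 1, 3]"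
proof -
  \<comment> \<open>These bounds keep the truncated subtraction from n + 1 strictly
    decreasing.\<close>
  have bound: "a \<le> n" "b \<le> n" "c \<le> n"
    if "subseq [a, b, c] \<rho>" "\<rho> \<in> permutations_of_set {1..n}" for a b c \<rho>
    using set_subseq[OF that(1)] that(2) by (auto simp: permutations_of_set_def)
  show ?thesis
    unfolding avoids_132_iff_subseq avoids_213_iff_subseq
  proof (intro iffI allI impI)
    fix a b c
    assume av: "\<forall>a b c. subseq [a, b, c] (rev_comp n \<pi>) \<longrightarrow> \<not> (a < c \<and> c < b)"
      and sub: "subseq [a, b, c] \<pi>"
    have "subseq [n + 1 - c, n + 1 - b, n + 1 - a] (rev_comp n \<pi>)"
      using subseq_rev_comp[OF sub, of n] by (simp add: rev_comp_def)
    with av have "\<not> (n + 1 - c < n + 1 - a \<and> n + 1 - a < n + 1 - b)" by blast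
    with bound[OF sub assms] show "\<not> (b < a \<and> a < c)" by linarith
  next
    fix a b c
    assume av: "\<forall>a b c. subseq [a, b, c] \<pi> \<longrightarrow> \<not> (b < a \<and> a < c)"
      and sub: "subseq [a, b, c] (rev_comp n \<pi>)"
    have "subseq [n + 1 - c, n + 1 - b, n + 1 - a] \<pi>"
      using subseq_rev_comp[OF sub, of n] rev_comp_rev_comp[OF assms] by (simp add: rev_comp_def)
    with av have "\<not> (n + 1 - b < n + 1 - c \<and> n + 1 - c < n + 1 - a)" by blast
    with bound[OF sub rev_comp_in_perms[OF assms]] show "\<not> (a < c \<and> c < b)" by linarith
  qed
qed

text \<open>Reversal and complementation each flip the comparison of two neighbours, so together
  they preserve it.\<close>

lemma descents_rev_comp:
  assumes "\<pi> \<in> permutations_of_set {1..n}"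
  shows "descents (rev_comp n \<pi>) = descents \<pi>"
proof -
  have len: "length \<pi> = n" and set: "set \<pi> = {1..n}"
    using assms length_finite_permutations_of_set[of \<pi> "{1..n}"]
    by (auto simp: permutations_of_set_def)
  have range: "1 \<le> \<pi> ! i" "\<pi> ! i \<le> n" if "i < n" for i
    using nth_mem[of i \<pi>] that len set by auto
  have nth: "rev_comp n \<pi> ! i = n + 1 - \<pi> ! (n - Suc i)" if "i < n" for i
    using that len by (simp add: rev_comp_def rev_nth)
  let ?D = "\<lambda>\<pi>. {i. Suc i < length \<pi> \<and> \<pi> ! i > \<pi> ! Suc i}"
  \<comment> \<open>With indices from 0, the positions i and i+1 come from n-1-i and n-2-i, so the
    pair starts at n-2-i.\<close>
  have iff: "i \<in> ?D (rev_comp n \<pi>) \<longleftrightarrow> n - 2 - i \<in> ?D \<pi>" if i: "Suc i < n" for i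
  proof -
    define k where "k = n - 2 - i"
    have n: "n = Suc (Suc (i + k))" using i by (simp add: k_def)
    have "rev_comp n \<pi> ! i > rev_comp n \<pi> ! Suc i \<longleftrightarrow> \<pi> ! k > \<pi> ! Suc k"
      using nth[of i] nth[of "Suc i"] range[of k] range[of "Suc k"] n by auto
    moreover have "length (rev_comp n \<pi>) = n" using len by (simp add: rev_comp_def)
    ultimately show ?thesis using n len unfolding k_def[symmetric] by simp
  qed
  have "bij_betw (\<lambda>i. n - 2 - i) (?D (rev_comp n \<pi>)) (?D \<pi>)"
  proof (rule bij_betw_byWitness[where f' = "\<lambda>i. n - 2 - i"])
    have l: "Suc i < n" if "i \<in> ?D (rev_comp n \<pi>)" for i using that len by (simp add: rev_comp_def)
    show "(\<lambda>i. n - 2 - i) ` ?D (rev_comp n \<pi>) \<subseteq> ?D \<pi>" using iff l by blast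
    show "(\<lambda>i. n - 2 - i) ` ?D \<pi> \<subseteq> ?D (rev_comp n \<pi>)"
    proof (rule image_subsetI)
      fix i assume i: "i \<in> ?D \<pi>"
      then have "Suc i < n" using len by simp
      then have "Suc (n - 2 - i) < n" "n - 2 - (n - 2 - i) = i" by auto
      then show "n - 2 - i \<in> ?D (rev_comp n \<pi>)" using iff[of "n - 2 - i"] i by simp
    qed
  qed (use len in \<open>auto simp: rev_comp_def\<close>)
  then show ?thesis unfolding descents_def by (rule bij_betw_same_card)
qed

text \<open>Behind the block {1..i} stand the letters {i+1..n}; reversal moves them to the front and
  complementation maps them onto {1..n-i}.\<close>

lemma decomposable_rev_comp:
  assumes "\<pi> \<in> permutations_of_set {1..n}" "i \<in> {1..<n}" "set (take i \<pi>) = {1..i}"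
  shows "n - i \<in> {1..<n}" "set (take (n - i) (rev_comp n \<pi>)) = {1..n-i}"
proof -
  have len: "length \<pi> = n" and set: "set \<pi> = {1..n}" and dist: "distinct \<pi>"
    using assms length_finite_permutations_of_set[of \<pi> "{1..n}"]
    by (auto simp: permutations_of_set_def)
  show "n - i \<in> {1..<n}" using assms(2) by auto
  have "set (drop i \<pi>) = set \<pi> - set (take i \<pi>)"
    using dist set_take_disj_set_drop_if_distinct[of \<pi> i i] set_append[of "take i \<pi>" "drop i \<pi>"]
    by auto
  also have "\<dots> = {i+1..n}" using set assms(3) by auto
  finally have "set (take (n - i) (rev_comp n \<pi>)) = (\<lambda>x. n + 1 - x) ` {i+1..n}"
    using len assms(2) by (simp add: rev_comp_def take_rev drop_map)
  also have "\<dots> = {1..n-i}"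
    by (rule image_reflect)
  finally show "set (take (n - i) (rev_comp n \<pi>)) = {1..n-i}" .
qed

lemma indecomposable_rev_comp:
  assumes "\<pi> \<in> permutations_of_set {1..n}" "n \<ge> 1"
  shows "indecomposable (rev_comp n \<pi>) \<longleftrightarrow> indecomposable \<pi>"
  using indecomposable_iff[OF assms] indecomposable_iff[OF rev_comp_in_perms[OF assms(1)] assms(2)]
    decomposable_rev_comp[OF assms(1)] decomposable_rev_comp[OF rev_comp_in_perms[OF assms(1)]]
    rev_comp_rev_comp[OF assms(1)]
  by metis

text \<open>The involution \<open>rev_comp n\<close> is its own inverse witness for a bijection
  between the two sets. The abstract P and Q allow one transfer for A and I alike.\<close>

lemma card_rev_comp:
  assumes "\<And>\<pi>. \<pi> \<in> permutations_of_set {1..n} \<Longrightarrow> P (rev_comp n \<pi>) \<longleftrightarrow> Q \<pi>"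
  shows "card {\<pi> \<in> permutations_of_set {1..n}. Q \<pi>} = card {\<pi> \<in> permutations_of_set {1..n}. P \<pi>}"
proof (rule bij_betw_same_card[OF bij_betw_byWitness[where f = "rev_comp n" and f' = "rev_comp n"]])
  show "rev_comp n ` {\<pi> \<in> permutations_of_set {1..n}. P \<pi>} \<subseteq> {\<pi> \<in> permutations_of_set {1..n}. Q \<pi>}"
    by (auto simp: rev_comp_in_perms rev_comp_rev_comp assms[OF rev_comp_in_perms, symmetric]
        simp del: One_nat_def)
qed (use assms in \<open>auto simp: rev_comp_in_perms rev_comp_rev_comp simp del: One_nat_def\<close>)

lemma A_num_213: "A_num [2, 1, 3] n i = A_num [1, 3, 2] n i"
  unfolding A_num_def by (rule card_rev_comp) (metis avoids_rev_comp descents_rev_comp)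

lemma I_num_213:
  assumes "n \<ge> 1"
  shows "I_num [2, 1, 3] n i = I_num [1, 3, 2] n i"
  unfolding I_num_def
  by (rule card_rev_comp) (metis assms avoids_rev_comp descents_rev_comp indecomposable_rev_comp)

lemma A_gf_213: "A_gf [2, 1, 3] = A_gf [1, 3, 2]"
  by (simp only: A_gf_def A_num_213)

lemma I_gf_213: "I_gf [2, 1, 3] = I_gf [1, 3, 2]"
  unfolding I_gf_def by (intro fps_ext) (auto simp: I_num_213 simp del: One_nat_def)

section \<open>The relation between the series A and I\<close>

lemma permutations_of_set_one: "permutations_of_set {1..Suc 0} = {[Suc 0]}"
  by simp

text \<open>Degree 1 in x is separate: A - 1 has no constant term, so nothing is subtracted
  there.\<close>

lemma A_num_eq_I_num_one: "A_num [1, 3, 2] (Suc 0) i = I_num [1, 3, 2] (Suc 0) i"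
  unfolding A_num_def I_num_def permutations_of_set_one
  by (rule arg_cong[where f = card]) (auto simp: indecomposable_singleton)

lemma A_gf_132: "A_gf [1, 3, 2] = 1 + 1 / (1 - fps_X) * I_gf [1, 3, 2]"
proof -
  let ?B = "A_gf [1, 3, 2] - 1" and ?I = "I_gf [1, 3, 2]"
  have "(1 - fps_X) * ?B = ?I"
  proof (rule fps_ext)
    fix n
    consider "n = 0" | "n = 1" | m where "n = Suc m" "m \<ge> 1"
      by (metis One_nat_def Suc_le_eq not0_implies_Suc zero_less_Suc)
    then show "fps_nth ((1 - fps_X) * ?B) n = fps_nth ?I n"
    proof cases
      case 3
      then show ?thesis
        by (auto simp: A_gf_def I_gf_def left_diff_distrib A_num_132_Suc intro!: fps_ext
            simp del: One_nat_def)
    qed (use A_num_eq_I_num_one in \<open>auto simp: A_gf_def I_gf_def left_diff_distrib\<close>)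
  qed
  then have "1 / (1 - fps_X) * ?I = (1 / (1 - fps_X) * (1 - fps_X)) * ?B"
    by (simp add: mult.assoc)
  then show ?thesis by (simp add: one_minus_X_inverse)
qed

section \<open>The Catalan series and the square root of 1 - 4x\<close>

abbreviation catalan_fps :: "real fps" where
  "catalan_fps \<equiv> Abs_fps catalan"

lemma catalan_0 [simp]: "catalan 0 = 1"
  by (simp add: catalan_def)

lemma catalan_1 [simp]: "catalan 1 = 1" "catalan (Suc 0) = 1"
  by (simp_all add: catalan_def)

text \<open>Two absorption identities and the symmetry of row 2n+1 give (n+1) binom(2n+2, n+1) = 2
  (2n+1) binom(2n, n).\<close>

lemma catalan_Suc: "(real n + 2) * catalan (Suc n) = (4 * real n + 2) * catalan n"
proof -
  have "Suc n * ((2 * Suc n) choose Suc n) = (2 * Suc n) * (Suc (2 * n) choose n)"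
    using Suc_times_binomial_eq[of "Suc (2 * n)" n] by (simp add: mult.commute)
  moreover have "Suc (2 * n) choose n = Suc (2 * n) choose Suc n"
    by (subst binomial_symmetric) auto
  moreover have "Suc n * (Suc (2 * n) choose Suc n) = Suc (2 * n) * ((2 * n) choose n)"
    using Suc_times_binomial_eq[of "2 * n" n] by (simp add: mult.commute)
  ultimately have "Suc n * (Suc n * ((2 * Suc n) choose Suc n)) = 2 * Suc n * (Suc (2 * n) * ((2 * n) choose n))"
    by (metis mult.assoc mult.left_commute)
  then have "Suc n * ((2 * Suc n) choose Suc n) = 2 * (Suc (2 * n) * ((2 * n) choose n))"
    by (metis Suc_mult_cancel1 mult.left_commute mult.assoc)
  then have "real (Suc n) * real ((2 * Suc n) choose Suc n) =
      2 * (real (Suc (2 * n)) * real ((2 * n) choose n))"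
    by (metis of_nat_mult of_nat_numeral)
  then have "(real n + 1) * real ((2 * Suc n) choose Suc n) = (4 * real n + 2) * real ((2 * n) choose n)"
    by (simp add: algebra_simps del: binomial_Suc_Suc mult_Suc_right)
  then show ?thesis
    unfolding catalan_def by (simp add: field_simps del: binomial_Suc_Suc mult_Suc_right)
qed

text \<open>Comparing coefficients gives (n+1) f_(n+1) = 4 (n-1) f_n. The factor n-1 vanishes at n =
  1, which kills every coefficient from degree 2 on.\<close>

lemma fps_one_minus_4X_ode_unique:
  fixes F :: "real fps"
  assumes "(1 - 4 * fps_X) * fps_deriv F = - 4 * F" "fps_nth F 0 = 1"
  shows "F = 1 - 4 * fps_X"
proof (rule fps_ext)
  fix n
  have rec: "fps_nth F (Suc n) * real (Suc n) = 4 * (real n - 1) * fps_nth F n" for n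
  proof -
    have "fps_nth ((1 - 4 * fps_X) * fps_deriv F) n = - 4 * fps_nth F n"
      using assms(1) by (simp add: numeral_fps_const)
    then show ?thesis
      by (cases n) (simp_all add: left_diff_distrib numeral_fps_const mult.assoc algebra_simps)
  qed
  have one: "fps_nth F 1 = - 4" using rec[of 0] assms(2) by simp
  have big: "fps_nth F (Suc (Suc m)) = 0" for m
  proof (induction m)
    case 0
    then show ?case using rec[of 1] by simp
  next
    case (Suc m)
    then show ?case using rec[of "Suc (Suc m)"] by simp
  qed
  consider "n = 0" | "n = 1" | m where "n = Suc (Suc m)"
    by (metis One_nat_def not0_implies_Suc)
  then show "fps_nth F n = fps_nth (1 - 4 * fps_X) n"
    by cases (use assms(2) one big in \<open>auto simp: numeral_fps_const\<close>)
qed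

text \<open>The constant term 1 selects the branch of the root.\<close>

lemma fps_sqrt_eqI:
  assumes "F ^ 2 = 1 - 4 * fps_X" "fps_nth F 0 = 1"
  shows "fps_sqrt (1 - 4 * fps_X) = F"
proof -
  have "fps_nth (1 - 4 * fps_X :: real fps) 0 = 1" by simp
  then show ?thesis
    using radical_unique[of root 1 "1 - 4 * fps_X" F] assms by (simp add: numeral_2_eq_2)
qed

lemma fps_sqrt_eq_catalan: "fps_sqrt (1 - 4 * fps_X) = 1 - 2 * fps_X * catalan_fps"
proof (rule fps_sqrt_eqI)
  let ?D = "1 - 2 * fps_X * catalan_fps"
  \<comment> \<open>The equation satisfied by the square root of 1 - 4x; in degree n \<ge> 1 it is
    \<open>catalan_Suc\<close> at n - 1.\<close>
  have "(1 - 4 * fps_X) * fps_deriv ?D = - 2 * ?D"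
  proof (rule fps_ext)
    fix n
    show "fps_nth ((1 - 4 * fps_X) * fps_deriv ?D) n = fps_nth (- 2 * ?D) n"
      using catalan_Suc[of "n - 1"]
      by (cases n) (simp_all add: left_diff_distrib numeral_fps_const mult.assoc algebra_simps)
  qed
  \<comment> \<open>Multiply by 2D and use (D^2)' = 2 D D'.\<close>
  then have "(1 - 4 * fps_X) * fps_deriv (?D ^ 2) = - 4 * ?D ^ 2"
    unfolding power2_eq_square fps_deriv_mult by (simp add: algebra_simps) algebra
  then show "?D ^ 2 = 1 - 4 * fps_X"
    by (rule fps_one_minus_4X_ode_unique) (simp add: power2_eq_square)
qed simp

lemma card_av132_perms: "real (card (av132_perms {1..n})) = catalan n"
proof -
  define G where "G = Abs_fps (\<lambda>n. real (card (av132_perms {1..n})))"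
  have GG: "fps_nth (G * G) n = real (card (av132_perms {1..Suc n}))" for n
    unfolding card_av132_perms_Suc by (simp add: G_def fps_mult_nth atLeast0AtMost)
  have "G = 1 + fps_X * G ^ 2"
  proof (rule fps_ext)
    fix n
    have "av132_perms {} = {[]}" by (auto simp: av132_perms_iff)
    then show "fps_nth G n = fps_nth (1 + fps_X * G ^ 2) n"
      by (cases n) (simp_all add: power2_eq_square GG, simp_all add: G_def)
  qed
  \<comment> \<open>Completing the square: (1 - 2xG)^2 = 1 - 4x (G - x G^2), and the last bracket is
    1.\<close>
  then have "(1 - 2 * fps_X * G) ^ 2 = 1 - 4 * fps_X" by algebra
  then have "fps_sqrt (1 - 4 * fps_X) = 1 - 2 * fps_X * G" by (rule fps_sqrt_eqI) simp
  then have "2 * fps_X * G = 2 * fps_X * catalan_fps" unfolding fps_sqrt_eq_catalan by simp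
  then have "G = catalan_fps" by simp
  then show ?thesis unfolding G_def by (simp add: fps_eq_iff)
qed

section \<open>Counting indecomposable avoiders at q = 1\<close>

text \<open>The case n = 1 is an exception: C_1 - C_0 would be 0, but the only permutation of [1] is
  indecomposable.\<close>

lemma I_gf1_132_nth:
  assumes "n \<ge> 1"
  shows "fps_nth (I_gf1 [1, 3, 2]) n = (if n = 1 then 1 else catalan n - catalan (n - 1))"
proof -
  have eq: "fps_nth (I_gf1 [1, 3, 2]) n = real (card {\<pi> \<in> av132_perms {1..n}. indecomposable \<pi>})"
    unfolding I_gf1_nth[OF assms] avoids_132_iff av132_perms_def by (simp add: conj_ac)
  show ?thesis
  proof (cases "n = 1")
    case True
    have "{\<pi> \<in> av132_perms {1..1}. indecomposable \<pi>} = {[Suc 0]}"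
      by (auto simp: av132_perms_def indecomposable_singleton)
    then show ?thesis using eq True by simp
  next
    case False
    then obtain m where m: "n = Suc m" "m \<ge> 1" using assms by (cases n) auto
    then show ?thesis
      using eq card_indecomposable_132_Suc[OF m(2)] card_av132_perms[of m] card_av132_perms[of n]
      by simp
  qed
qed

lemma I_gf1_132:
  "I_gf1 [1, 3, 2] = (1 - fps_X) * ((1 - fps_sqrt (1 - 4 * fps_X)) / (2 * fps_X) - 1)"
proof -
  have "(1 - fps_sqrt (1 - 4 * fps_X)) / (2 * fps_X) = catalan_fps"
    unfolding fps_sqrt_eq_catalan by simp
  \<comment> \<open>Removing the constant term C_0 makes the coefficient in degree 1 equal to C_1 =
    1, which absorbs the exceptional case.\<close>
  moreover have "I_gf1 [1, 3, 2] = (1 - fps_X) * (catalan_fps - 1)"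
  proof (rule fps_ext)
    fix n
    have "fps_nth (I_gf1 [1, 3, 2]) 0 = 0"
      by (simp add: I_gf1_def specialize_q_def I_gf_def)
    then show "fps_nth (I_gf1 [1, 3, 2]) n = fps_nth ((1 - fps_X) * (catalan_fps - 1)) n"
      by (cases "n = 0") (auto simp: I_gf1_132_nth left_diff_distrib simp del: One_nat_def)
  qed
  ultimately show ?thesis by simp
qed

theorem theorem3p7:
  fixes \<sigma> :: "nat list"
  assumes "\<sigma> \<in> {[1, 3, 2], [2, 1, 3]}"
  shows "A_gf \<sigma> = 1 + 1 / (1 - fps_X) * I_gf \<sigma> \<and>
         I_gf1 \<sigma> = (1 - fps_X) * ((1 - fps_sqrt (1 - 4 * fps_X)) / (2 * fps_X) - 1) \<and>
         fps_nth (I_gf1 \<sigma>) 1 = 1 \<and>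
         (\<forall>n\<ge>2. fps_nth (I_gf1 \<sigma>) n = catalan n - catalan (n - 1))"
proof -
  have "A_gf \<sigma> = A_gf [1, 3, 2]" "I_gf \<sigma> = I_gf [1, 3, 2]" "I_gf1 \<sigma> = I_gf1 [1, 3, 2]"
    using assms by (auto simp: A_gf_213 I_gf_213 I_gf1_def simp del: One_nat_def)
  moreover have "fps_nth (I_gf1 [1, 3, 2]) 1 = 1"
    "\<forall>n\<ge>2. fps_nth (I_gf1 [1, 3, 2]) n = catalan n - catalan (n - 1)"
    using I_gf1_132_nth by simp_all
  ultimately show ?thesis using A_gf_132 I_gf1_132 by simp
qed

end
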